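(* Let $\mathfrak{k}$ be a field of characteristic $0$, and let $f_1(x)=\alpha_0x^{n-1}+\alpha_1x^{n-2}+\dots+\alpha_{n-1}$ and $f_2(x)=\beta_0x^{n-2}+\beta_1x^{n-3}+\dots+\beta_{n-2}$ be two arbitrary polynomials in $\mathfrak{k}[x]$ of degrees $n-1$ and $n-2$ respectively. Let $f_3,f_4,\dots$ be defined from $f_1,f_2$ by the signed Euclidean algorithm. Let $j\ge1$ and suppose that $\deg f_j=n-j$ (hence $\deg f_i=n-i$ for all $i\le j$). Then for all $1\le i\le j$ one has $c(i)\ne0$ (so that $\tilde\gamma_1,\dots,\tilde\gamma_j$ are well defined) and $$f_i(x)=\tilde\gamma_i\cdot\sum_{p=0}^{n-i}c(i)_p\,x^{n-i-p}.$$ In particular, the leading coefficient of $f_i(x)$ is $\tilde\gamma_i\,c(i)$. Here the elements $c(i)_p$, $c(i)=c(i)_0$ and $\tilde\gamma_i$ of $\mathfrak{k}$ are the explicit expressions in the coefficients of $f_1,f_2$ given in the context.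
   Context: Signed Euclidean algorithm: for $j\ge2$, $f_{j+1}$ is minus the remainder of the Euclidean division of $f_{j-1}$ by $f_j$: $f_{j-1}=q_{j-1}f_j-f_{j+1}$ with $\deg f_{j+1}<\deg f_j$. Put $\alpha_i=0$ for $i>n-1$ and $\beta_i=0$ for $i>n-2$. For $i\ge0$ set $c(1)_i=\alpha_i/\alpha_0$, $c(1)=c(1)_0=1$, and $b(1)_{i+2}=\beta_i$. For $k\ge2$ and $i\ge2k$ define $b(k)_i$ by recursion on $k$: $$b(k)_i=b(k-1)_i+c(1)_{k-1}\,b(1)_{i-k+1}-c(1)_{i-k}\,b(1)_k.$$ For $m\ge2$ let $C(m)$ be the symmetric $(m-1)\times(m-1)$ matrix whose $(p,q)$ entry is $b(\min(p,q))_{p+q}$, $1\le p,q\le m-1$. For $i\ge0$ let $C(m)_i$ be the matrix obtained from $C(m)$ by replacing its last row by $$\bigl(b(1)_{m+i},\,b(2)_{m+i+1},\dots,\,b(m-1)_{2m+i-2}\bigr).$$ Put $c(m)_i=\det C(m)_i$ and $c(m)=c(m)_0$. Define $\tilde\gamma_1=\alpha_0$, $\tilde\gamma_2=1$, and $\tilde\gamma_{j+1}=\tilde\gamma_{j-1}\dfrac{c(j-1)^2}{c(j)^2}$ for $j\ge2$. *)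

theory Defs
  imports
    "HOL-Computational_Algebra.Polynomial"
    "Jordan_Normal_Form.Determinant"
begin

(* Sequences produced by the algorithm are indexed from 1; index 0 is a dummy.
   Once some f_j = 0 the algorithm has stopped. The explicit test is needed
   because p mod 0 = p, which would otherwise restart the sequence; after
   termination all further entries are 0. *)
fun signed_euclid :: "'a::field poly \<Rightarrow> 'a poly \<Rightarrow> nat \<Rightarrow> 'a poly" where
  "signed_euclid f1 f2 0 = 0"
| "signed_euclid f1 f2 (Suc 0) = f1"
| "signed_euclid f1 f2 (Suc (Suc 0)) = f2"
| "signed_euclid f1 f2 (Suc (Suc (Suc k))) =
     (if signed_euclid f1 f2 (Suc (Suc k)) = 0 then 0
      else - (signed_euclid f1 f2 (Suc k) mod signed_euclid f1 f2 (Suc (Suc k))))"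

definition c1 :: "(nat \<Rightarrow> 'a::field) \<Rightarrow> nat \<Rightarrow> 'a" where
  "c1 \<alpha> i = \<alpha> i / \<alpha> 0"

(* b(1)_i, meaningful for i >= 2 *)
definition b1 :: "(nat \<Rightarrow> 'a::field) \<Rightarrow> nat \<Rightarrow> 'a" where
  "b1 \<beta> i = \<beta> (i - 2)"

(* b(k)_i, meaningful for k >= 1 and i >= 2 * k; in that range none of the
   subtractions on nat truncates. *)
fun b :: "(nat \<Rightarrow> 'a::field) \<Rightarrow> (nat \<Rightarrow> 'a) \<Rightarrow> nat \<Rightarrow> nat \<Rightarrow> 'a" where
  "b \<alpha> \<beta> 0 i = 0"
| "b \<alpha> \<beta> (Suc 0) i = b1 \<beta> i"
| "b \<alpha> \<beta> (Suc (Suc l)) i =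
     (let k = l + 2 in
        b \<alpha> \<beta> (Suc l) i + c1 \<alpha> (k - 1) * b1 \<beta> (i - k + 1) - c1 \<alpha> (i - k) * b1 \<beta> k)"

(* Matrix positions (r, s) are counted from 0, so that (p, q) = (r + 1, s + 1). *)
definition Cmat :: "(nat \<Rightarrow> 'a::field) \<Rightarrow> (nat \<Rightarrow> 'a) \<Rightarrow> nat \<Rightarrow> 'a mat" where
  "Cmat \<alpha> \<beta> m =
     mat (m - 1) (m - 1) (\<lambda>(r, s). b \<alpha> \<beta> (min (r + 1) (s + 1)) ((r + 1) + (s + 1)))"

(* The entry of the new last row in column q = s + 1 is b(q)_{m+i+q-1}. *)
definition Cmat_row :: "(nat \<Rightarrow> 'a::field) \<Rightarrow> (nat \<Rightarrow> 'a) \<Rightarrow> nat \<Rightarrow> nat \<Rightarrow> 'a mat" where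
  "Cmat_row \<alpha> \<beta> m i =
     mat (m - 1) (m - 1)
       (\<lambda>(r, s). if r + 1 = m - 1 then b \<alpha> \<beta> (s + 1) (m + i + s) else Cmat \<alpha> \<beta> m $$ (r, s))"

(* c(m)_i for m >= 1; the element c(m) is c(m)_0. *)
definition c :: "(nat \<Rightarrow> 'a::field) \<Rightarrow> (nat \<Rightarrow> 'a) \<Rightarrow> nat \<Rightarrow> nat \<Rightarrow> 'a" where
  "c \<alpha> \<beta> m i = (if m = 1 then c1 \<alpha> i else det (Cmat_row \<alpha> \<beta> m i))"

(* Indexed from 1; index 0 is a dummy. In the last equation j = k + 2. *)
fun gamma_tilde :: "(nat \<Rightarrow> 'a::field) \<Rightarrow> (nat \<Rightarrow> 'a) \<Rightarrow> nat \<Rightarrow> 'a" where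
  "gamma_tilde \<alpha> \<beta> 0 = 0"
| "gamma_tilde \<alpha> \<beta> (Suc 0) = \<alpha> 0"
| "gamma_tilde \<alpha> \<beta> (Suc (Suc 0)) = 1"
| "gamma_tilde \<alpha> \<beta> (Suc (Suc (Suc k))) =
     gamma_tilde \<alpha> \<beta> (Suc k) * (c \<alpha> \<beta> (Suc k) 0)\<^sup>2 / (c \<alpha> \<beta> (Suc (Suc k)) 0)\<^sup>2"

end

theory Submission
  imports Defs
begin

text \<open>
  Write \<open>a i = \<alpha> i / \<alpha> 0\<close>. The numbers \<open>b(q)_(p+q)\<close> are the entries of the Bezout matrix of
  \<open>f1 / \<alpha> 0\<close> and \<open>f2\<close>: unfolding the recursion for \<open>b\<close> gives the Bezout recursion along antidiagonals,
  which also shows that the matrix is symmetric. Hence \<open>c(m)_i\<close> is the minor of the Bezout matrix on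
  the rows \<open>1, ..., m - 2, m - 1 + i\<close> and the columns \<open>1, ..., m - 1\<close>.

  Reading the \<open>q\<close>-th column of the Bezout matrix as a polynomial of degree at most \<open>n - 2\<close> gives an
  element of the ideal \<open>(f1, f2)\<close>: modulo \<open>f1\<close> it is \<open>U_q * f2\<close>, where \<open>U_q\<close> is monic of degree
  \<open>q - 1\<close> (lemma \<open>bezout_column_cong\<close>). Expanding the minors \<open>c(m)_i\<close> along their last row shows
  that \<open>S_m = (\<Sum>p. c(m)_p x^(n-m-p))\<close> is a combination of the first \<open>m - 1\<close> columns, so modulo \<open>f1\<close>
  it is \<open>U * f2\<close> with \<open>degree U \<le> m - 2\<close>, and the coefficient of \<open>U\<close> at \<open>x^(m-2)\<close> is the corner
  minor \<open>c(m-1)\<close> (lemma \<open>minor_poly_cong\<close>).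

  The extended Euclidean algorithm gives polynomials \<open>A_i\<close> with \<open>f_i\<close> congruent to \<open>A_i * f2\<close> modulo
  \<open>f1\<close>, with \<open>degree A_i \<le> i - 2\<close> and \<open>f_(i-1) A_i - f_i A_(i-1) = f1\<close>. Since the cofactors have such
  small degrees, \<open>S_m\<close> and \<open>f_m\<close> must be proportional (lemma \<open>small_cofactors_proportional\<close>), and
  leading coefficients give the ratio: \<open>S_m = (\<gamma>_(m-1) c(m-1)^2 / \<alpha> 0) f_m\<close>, where \<open>\<gamma>\<close> is
  \<open>gamma_tilde\<close>. This agrees with the claim because the recursion for \<open>\<gamma>\<close> says exactly that
  \<open>\<gamma>_(m-1) \<gamma>_m c(m-1)^2\<close> always equals \<open>\<alpha> 0\<close>.
\<close>

section \<open>Polynomials given by descending coefficients\<close>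

definition dpoly :: "nat \<Rightarrow> (nat \<Rightarrow> 'a::field) \<Rightarrow> 'a poly" where
  "dpoly N g = (\<Sum>i\<le>N. monom (g i) (N - i))"

lemma coeff_dpoly: "coeff (dpoly N g) k = (if k \<le> N then g (N - k) else 0)"
proof -
  have "coeff (dpoly N g) k = (\<Sum>i\<le>N. if N - i = k then g i else 0)"
    by (simp add: dpoly_def coeff_sum)
  also have "\<dots> = (\<Sum>i\<le>N. if i = N - k then (if k \<le> N then g i else 0) else 0)"
    by (rule sum.cong) auto
  also have "\<dots> = (if k \<le> N then g (N - k) else 0)"
    by (subst sum.delta) auto
  finally show ?thesis .
qed

lemma degree_dpoly_le: "degree (dpoly N g) \<le> N"
  by (rule degree_le) (simp add: coeff_dpoly)

lemma degree_dpoly: "g 0 \<noteq> 0 \<Longrightarrow> degree (dpoly N g) = N"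
  by (rule antisym[OF degree_dpoly_le], rule le_degree) (simp add: coeff_dpoly)


section \<open>The Bezout matrix\<close>

definition bez :: "(nat \<Rightarrow> 'a::field) \<Rightarrow> (nat \<Rightarrow> 'a) \<Rightarrow> nat \<Rightarrow> nat \<Rightarrow> 'a" where
  "bez \<alpha> \<beta> p q = b \<alpha> \<beta> q (p + q)"

lemma bez_1: "bez \<alpha> \<beta> (Suc p) (Suc 0) = \<beta> p"
  by (simp add: bez_def b1_def)

text \<open>In terms of \<open>B_i = b(1)_i = \<beta> (i - 2)\<close> this is the usual Bezout recursion from \<open>(p, q)\<close> to
  \<open>(p + 1, q - 1)\<close>, with difference \<open>a_(q-1) B_(p+1) - a_p B_q\<close>.\<close>
lemma bez_Suc:
  "bez \<alpha> \<beta> (Suc p) (Suc (Suc q)) =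
     bez \<alpha> \<beta> (Suc (Suc p)) (Suc q) + c1 \<alpha> (Suc q) * \<beta> p - c1 \<alpha> (Suc p) * \<beta> q"
proof -
  have eqs: "Suc p + Suc (Suc q) - (q + 2) + 1 = Suc (Suc p)"
    "Suc p + Suc (Suc q) - (q + 2) = Suc p"
    "Suc p + Suc (Suc q) = Suc (Suc p) + Suc q" "q + 2 - 1 = Suc q" by auto
  have "bez \<alpha> \<beta> (Suc p) (Suc (Suc q)) =
      b \<alpha> \<beta> (Suc q) (Suc p + Suc (Suc q))
      + c1 \<alpha> (q + 2 - 1) * b1 \<beta> (Suc p + Suc (Suc q) - (q + 2) + 1)
      - c1 \<alpha> (Suc p + Suc (Suc q) - (q + 2)) * b1 \<beta> (q + 2)"
    unfolding bez_def by (simp only: b.simps Let_def)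
  then show ?thesis
    unfolding eqs(1) eqs(2) eqs(4) by (simp add: bez_def b1_def)
qed

text \<open>Moving one step inwards along the antidiagonal from \<open>(p, q)\<close> and from \<open>(q, p)\<close> changes the two
  entries by the same amount, so the symmetry propagates outwards from the diagonal.\<close>
lemma bez_sym_aux:
  "bez \<alpha> \<beta> (Suc p) (Suc (p + d)) = bez \<alpha> \<beta> (Suc (p + d)) (Suc p)"
proof (induction d arbitrary: p rule: less_induct)
  case (less d)
  consider "d = 0" | "d = 1" | e where "d = Suc (Suc e)"
    by (metis One_nat_def not0_implies_Suc)
  then show ?case
  proof cases
    case 1
    then show ?thesis by simp
  next
    case 2
    then show ?thesis using bez_Suc[of \<alpha> \<beta> p p] by simp
  next
    case 3
    have "bez \<alpha> \<beta> (Suc (Suc p)) (Suc (Suc p + e)) = bez \<alpha> \<beta> (Suc (Suc p + e)) (Suc (Suc p))"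
      using 3 by (intro less) simp
    then show ?thesis
      using bez_Suc[of \<alpha> \<beta> p "Suc (p + e)"] bez_Suc[of \<alpha> \<beta> "Suc (p + e)" p] 3
      by (simp add: algebra_simps)
  qed
qed

lemma bez_sym: "bez \<alpha> \<beta> (Suc p) (Suc q) = bez \<alpha> \<beta> (Suc q) (Suc p)"
proof (cases "p \<le> q")
  case True
  then show ?thesis using bez_sym_aux[of \<alpha> \<beta> p "q - p"] by simp
next
  case False
  then show ?thesis using bez_sym_aux[of \<alpha> \<beta> q "p - q"] by simp
qed

lemma bez_eq_0:
  assumes "\<And>i. i > N + 1 \<Longrightarrow> \<alpha> i = 0" and "\<And>i. i > N \<Longrightarrow> \<beta> i = 0" and "p > N"
  shows "bez \<alpha> \<beta> (Suc p) (Suc q) = 0"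
  using assms(3)
proof (induction q arbitrary: p)
  case 0
  then show ?case by (simp add: bez_1 assms)
next
  case (Suc q)
  then have "bez \<alpha> \<beta> (Suc (Suc p)) (Suc q) = 0" "\<alpha> (Suc p) = 0" "\<beta> p = 0"
    using assms by auto
  then show ?case by (simp add: bez_Suc c1_def)
qed

text \<open>This is the polynomial part of \<open>f1 / (\<alpha> 0 * x^(n-q))\<close>, where \<open>f1\<close> has degree \<open>n - 1\<close> and descending
  coefficients \<open>\<alpha> i\<close>.\<close>
fun bez_cofactor :: "(nat \<Rightarrow> 'a::field) \<Rightarrow> nat \<Rightarrow> 'a poly" where
  "bez_cofactor \<alpha> 0 = 0"
| "bez_cofactor \<alpha> (Suc q) = pCons (c1 \<alpha> q) (bez_cofactor \<alpha> q)"

lemma degree_bez_cofactor: "degree (bez_cofactor \<alpha> (Suc q)) \<le> q"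
proof (induction q)
  case (Suc q)
  then show ?case
    by (subst bez_cofactor.simps) (meson Suc_le_mono degree_pCons_le order.trans)
qed simp

lemma coeff_bez_cofactor: "\<alpha> 0 \<noteq> 0 \<Longrightarrow> coeff (bez_cofactor \<alpha> (Suc q)) q = 1"
proof (induction q)
  case (Suc q)
  then show ?case by (subst bez_cofactor.simps) (simp del: bez_cofactor.simps)
qed (simp add: c1_def)

text \<open>By the Bezout recursion the next column is \<open>x\<close> times the previous one plus \<open>a_q * f2\<close> minus
  a multiple of \<open>f1\<close>. In degree \<open>N + 1\<close> the terms cancel: the first row of the matrix equals
  its first column, which consists of the \<open>\<beta> i\<close>.\<close>
lemma bezout_column_cong:
  assumes "\<And>i. i > N + 1 \<Longrightarrow> \<alpha> i = 0" and "\<And>i. i > N \<Longrightarrow> \<beta> i = 0" and "\<alpha> 0 \<noteq> 0"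
  shows "dpoly (Suc N) \<alpha> dvd
    dpoly N (\<lambda>i. bez \<alpha> \<beta> (Suc i) (Suc q)) - bez_cofactor \<alpha> (Suc q) * dpoly N \<beta>"
proof (induction q)
  case 0
  have "bez_cofactor \<alpha> (Suc 0) = 1"
    using assms(3) by (simp add: c1_def)
  then show ?case by (simp only: bez_1) simp
next
  case (Suc q)
  let ?P = "\<lambda>q. dpoly N (\<lambda>i. bez \<alpha> \<beta> (Suc i) (Suc q))"
  have rec: "?P (Suc q) = pCons 0 (?P q) + smult (c1 \<alpha> (Suc q)) (dpoly N \<beta>)
      - smult (\<beta> q / \<alpha> 0) (dpoly (Suc N) \<alpha>)"
  proof (rule poly_eqI)
    fix k
    have last: "bez \<alpha> \<beta> (Suc (Suc N)) (Suc q) = 0"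
      using assms by (intro bez_eq_0[of N]) auto
    show "coeff (?P (Suc q)) k = coeff (pCons 0 (?P q) + smult (c1 \<alpha> (Suc q)) (dpoly N \<beta>)
      - smult (\<beta> q / \<alpha> 0) (dpoly (Suc N) \<alpha>)) k"
    proof (cases k)
      case 0
      then show ?thesis by (simp add: coeff_dpoly bez_Suc last c1_def)
    next
      case (Suc k')
      consider "k' < N" | "k' = N" | "k' > N" by linarith
      then show ?thesis
      proof cases
        case 1
        then have "Suc (N - Suc k') = N - k'" by simp
        with 1 Suc show ?thesis by (simp add: coeff_dpoly bez_Suc c1_def)
      next
        case 2
        with Suc assms(3) show ?thesis
          by (simp add: coeff_dpoly bez_sym[of \<alpha> \<beta> 0 q] bez_1)
      next
        case 3
        with Suc show ?thesis by (simp add: coeff_dpoly)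
      qed
    qed
  qed
  have "?P (Suc q) - bez_cofactor \<alpha> (Suc (Suc q)) * dpoly N \<beta>
      = [:0, 1:] * (?P q - bez_cofactor \<alpha> (Suc q) * dpoly N \<beta>)
        - smult (\<beta> q / \<alpha> 0) (dpoly (Suc N) \<alpha>)"
    unfolding rec bez_cofactor.simps(2)[of \<alpha> "Suc q"]
    by (simp add: algebra_simps del: bez_cofactor.simps)
  then show ?case
    using Suc by (metis dvd_diff dvd_mult dvd_refl dvd_smult)
qed


section \<open>The minors as coefficients of a polynomial\<close>

text \<open>Row \<open>r\<close> of the matrix is a row of the Bezout matrix also above the diagonal, where the
  minimum in its definition takes the transposed entry.\<close>
lemma Cmat_row_entry:
  assumes "r \<le> l" "s \<le> l"
  shows "Cmat_row \<alpha> \<beta> (Suc (Suc l)) i $$ (r, s) =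
           bez \<alpha> \<beta> (Suc (if r = l then l + i else r)) (Suc s)"
proof (cases "r = l")
  case True
  then show ?thesis
    using assms by (simp add: Cmat_row_def bez_def algebra_simps)
next
  case False
  then have "Cmat_row \<alpha> \<beta> (Suc (Suc l)) i $$ (r, s) = b \<alpha> \<beta> (Suc (min r s)) (Suc r + Suc s)"
    using assms by (simp add: Cmat_row_def Cmat_def)
  also have "\<dots> = bez \<alpha> \<beta> (Suc r) (Suc s)"
  proof (cases "s \<le> r")
    case True
    then show ?thesis by (simp add: bez_def min_def)
  next
    case False
    then show ?thesis
      by (subst bez_sym) (simp add: bez_def min_def add.commute)
  qed
  finally show ?thesis using False by simp
qed

lemma Cmat_row_carrier: "Cmat_row \<alpha> \<beta> (Suc (Suc l)) i \<in> carrier_mat (Suc l) (Suc l)"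
  by (simp add: Cmat_row_def)

lemma mat_delete_Cmat_row:
  "s \<le> l \<Longrightarrow> mat_delete (Cmat_row \<alpha> \<beta> (Suc (Suc l)) i) l s =
     mat_delete (Cmat_row \<alpha> \<beta> (Suc (Suc l)) 0) l s"
  by (rule eq_matI) (auto simp: mat_delete_def Cmat_row_def)

text \<open>The cofactors of the last row do not depend on the shift \<open>i\<close> of that row.\<close>
definition last_cofactor :: "(nat \<Rightarrow> 'a::field) \<Rightarrow> (nat \<Rightarrow> 'a) \<Rightarrow> nat \<Rightarrow> nat \<Rightarrow> 'a" where
  "last_cofactor \<alpha> \<beta> l s = cofactor (Cmat_row \<alpha> \<beta> (Suc (Suc l)) 0) l s"

lemma c_expansion:
  "c \<alpha> \<beta> (Suc (Suc l)) i = (\<Sum>s\<le>l. bez \<alpha> \<beta> (Suc (l + i)) (Suc s) * last_cofactor \<alpha> \<beta> l s)"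
proof -
  let ?M = "Cmat_row \<alpha> \<beta> (Suc (Suc l)) i"
  have "c \<alpha> \<beta> (Suc (Suc l)) i = (\<Sum>s<Suc l. ?M $$ (l, s) * cofactor ?M l s)"
    using laplace_expansion_row[OF Cmat_row_carrier, of l l \<alpha> \<beta> i] by (simp add: c_def)
  also have "\<dots> = (\<Sum>s<Suc l. bez \<alpha> \<beta> (Suc (l + i)) (Suc s) * last_cofactor \<alpha> \<beta> l s)"
  proof (rule sum.cong)
    fix s assume "s \<in> {..<Suc l}"
    then show "?M $$ (l, s) * cofactor ?M l s =
        bez \<alpha> \<beta> (Suc (l + i)) (Suc s) * last_cofactor \<alpha> \<beta> l s"
      using mat_delete_Cmat_row[of s l \<alpha> \<beta> i]
      by (simp add: Cmat_row_entry last_cofactor_def cofactor_def)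
  qed simp
  finally show ?thesis by (simp add: lessThan_Suc_atMost)
qed

text \<open>Expanding with a row that already occurs above the last one gives a determinant with two equal
  rows.\<close>
lemma foreign_row_expansion:
  assumes "r < l"
  shows "(\<Sum>s\<le>l. bez \<alpha> \<beta> (Suc r) (Suc s) * last_cofactor \<alpha> \<beta> l s) = 0"
proof -
  let ?M = "Cmat_row \<alpha> \<beta> (Suc (Suc l)) 0"
  note M = Cmat_row_carrier[of \<alpha> \<beta> l 0]
  have dim: "dim_row ?M = Suc l" "dim_col ?M = Suc l" using M by auto
  have "(?M * adj_mat ?M) $$ (r, l) = (det ?M \<cdot>\<^sub>m 1\<^sub>m (Suc l)) $$ (r, l)"
    using adj_mat(2)[OF M] by simp
  also have "\<dots> = 0" using assms by simp
  finally have "(\<Sum>s<Suc l. ?M $$ (r, s) * cofactor ?M l s) = 0"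
    using assms by (simp add: adj_mat_def scalar_prod_def dim atLeast0LessThan)
  moreover have "(\<Sum>s<Suc l. ?M $$ (r, s) * cofactor ?M l s)
      = (\<Sum>s<Suc l. bez \<alpha> \<beta> (Suc r) (Suc s) * last_cofactor \<alpha> \<beta> l s)"
    using assms by (intro sum.cong) (auto simp: Cmat_row_entry last_cofactor_def)
  ultimately show ?thesis by (simp add: lessThan_Suc_atMost)
qed

lemma last_cofactor_corner:
  assumes "\<alpha> 0 \<noteq> 0"
  shows "last_cofactor \<alpha> \<beta> l l = c \<alpha> \<beta> (Suc l) 0"
proof (cases l)
  case 0
  have "mat_delete (Cmat_row \<alpha> \<beta> (Suc (Suc 0)) 0) 0 0 \<in> carrier_mat 0 0"
    by (simp add: mat_delete_def Cmat_row_def)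
  then have "det (mat_delete (Cmat_row \<alpha> \<beta> (Suc (Suc 0)) 0) 0 0) = 1"
    by (rule det_dim_zero)
  with 0 assms show ?thesis
    by (simp add: last_cofactor_def cofactor_def c_def c1_def)
next
  case (Suc l')
  have "mat_delete (Cmat_row \<alpha> \<beta> (Suc (Suc l)) 0) l l = Cmat_row \<alpha> \<beta> (Suc l) 0"
  proof (rule eq_matI)
    fix r s assume "r < dim_row (Cmat_row \<alpha> \<beta> (Suc l) 0)" "s < dim_col (Cmat_row \<alpha> \<beta> (Suc l) 0)"
    then have rs: "r < l" "s < l" by (simp_all add: Cmat_row_def)
    then have "mat_delete (Cmat_row \<alpha> \<beta> (Suc (Suc l)) 0) l l $$ (r, s)
        = Cmat_row \<alpha> \<beta> (Suc (Suc l)) 0 $$ (r, s)"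
      by (simp add: mat_delete_def Cmat_row_def)
    also have "\<dots> = Cmat_row \<alpha> \<beta> (Suc l) 0 $$ (r, s)"
      using rs Suc by (simp add: Cmat_row_entry)
    finally show "mat_delete (Cmat_row \<alpha> \<beta> (Suc (Suc l)) 0) l l $$ (r, s)
        = Cmat_row \<alpha> \<beta> (Suc l) 0 $$ (r, s)" .
  qed (simp_all add: mat_delete_def Cmat_row_def)
  with Suc show ?thesis
    by (simp add: last_cofactor_def cofactor_def c_def)
qed

text \<open>The combination of the first \<open>l + 1\<close> Bezout columns with the last-row cofactors has zero
  coefficients in the rows above the last one, and the minors as its remaining coefficients.\<close>
lemma minor_poly_eq:
  assumes "l \<le> N"
  shows "dpoly (N - l) (c \<alpha> \<beta> (Suc (Suc l))) =
    (\<Sum>s\<le>l. smult (last_cofactor \<alpha> \<beta> l s) (dpoly N (\<lambda>i. bez \<alpha> \<beta> (Suc i) (Suc s))))"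
    (is "?S = ?R")
proof (rule poly_eqI)
  fix k
  have R: "coeff ?R k = (if k \<le> N then
      \<Sum>s\<le>l. bez \<alpha> \<beta> (Suc (N - k)) (Suc s) * last_cofactor \<alpha> \<beta> l s else 0)"
    by (simp add: coeff_sum coeff_dpoly mult.commute)
  consider "k \<le> N - l" | "N - l < k" "k \<le> N" | "k > N" by linarith
  then show "coeff ?S k = coeff ?R k"
  proof cases
    case 1
    then have "l + (N - l - k) = N - k" using assms by simp
    with 1 show ?thesis by (simp add: R coeff_dpoly c_expansion)
  next
    case 2
    then have "N - k < l" using assms by simp
    with 2 show ?thesis by (simp add: R coeff_dpoly foreign_row_expansion)
  next
    case 3
    then show ?thesis by (simp add: R coeff_dpoly)
  qed
qed

lemma minor_poly_cong:
  assumes "\<And>i. i > N + 1 \<Longrightarrow> \<alpha> i = 0" and "\<And>i. i > N \<Longrightarrow> \<beta> i = 0" and "\<alpha> 0 \<noteq> 0" and "l \<le> N"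
  obtains U where "degree U \<le> l" "coeff U l = c \<alpha> \<beta> (Suc l) 0"
    "dpoly (Suc N) \<alpha> dvd dpoly (N - l) (c \<alpha> \<beta> (Suc (Suc l))) - U * dpoly N \<beta>"
proof
  define U where "U = (\<Sum>s\<le>l. smult (last_cofactor \<alpha> \<beta> l s) (bez_cofactor \<alpha> (Suc s)))"
  show "degree U \<le> l"
    unfolding U_def
  proof (rule degree_sum_le)
    fix s assume "s \<in> {..l}"
    then show "degree (smult (last_cofactor \<alpha> \<beta> l s) (bez_cofactor \<alpha> (Suc s))) \<le> l"
      by (meson atMost_iff degree_bez_cofactor degree_smult_le order.trans)
  qed simp
  have "coeff U l = (\<Sum>s\<le>l. if s = l then last_cofactor \<alpha> \<beta> l s else 0)"
    unfolding U_def coeff_sum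
  proof (rule sum.cong)
    fix s assume "s \<in> {..l}"
    then have "s < l \<Longrightarrow> coeff (bez_cofactor \<alpha> (Suc s)) l = 0"
      using degree_bez_cofactor[of \<alpha> s] by (intro coeff_eq_0) simp
    with \<open>s \<in> {..l}\<close> show "coeff (smult (last_cofactor \<alpha> \<beta> l s) (bez_cofactor \<alpha> (Suc s))) l
        = (if s = l then last_cofactor \<alpha> \<beta> l s else 0)"
      using coeff_bez_cofactor[of \<alpha> l, OF assms(3)] by (auto simp del: bez_cofactor.simps)
  qed simp
  then show "coeff U l = c \<alpha> \<beta> (Suc l) 0"
    by (simp add: last_cofactor_corner assms(3))
  have "dpoly (N - l) (c \<alpha> \<beta> (Suc (Suc l))) - U * dpoly N \<beta> =
    (\<Sum>s\<le>l. smult (last_cofactor \<alpha> \<beta> l s)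
       (dpoly N (\<lambda>i. bez \<alpha> \<beta> (Suc i) (Suc s)) - bez_cofactor \<alpha> (Suc s) * dpoly N \<beta>))"
    by (simp add: minor_poly_eq[OF assms(4)] U_def sum_distrib_right sum_subtractf
        smult_diff_right del: bez_cofactor.simps)
  also have "dpoly (Suc N) \<alpha> dvd \<dots>"
    by (intro dvd_sum dvd_smult bezout_column_cong assms)
  finally show "dpoly (Suc N) \<alpha> dvd dpoly (N - l) (c \<alpha> \<beta> (Suc (Suc l))) - U * dpoly N \<beta>" .
qed


section \<open>The signed Euclidean algorithm\<close>

lemma signed_euclid_nonzero:
  assumes "signed_euclid f1 f2 j \<noteq> 0" "f1 \<noteq> 0" "1 \<le> i" "i \<le> j"
  shows "signed_euclid f1 f2 i \<noteq> 0"
  using assms(4,1)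
proof (induction j rule: dec_induct)
  case (step m)
  from \<open>1 \<le> i\<close> \<open>i \<le> m\<close> consider "m = 1" | k where "m = Suc (Suc k)"
    by (metis One_nat_def not0_implies_Suc not_one_le_zero order.trans)
  then show ?case
  proof cases
    case 1
    with step \<open>1 \<le> i\<close> assms(2) show ?thesis by simp
  next
    case 2
    with step show ?thesis by (auto split: if_splits)
  qed
qed simp

lemma signed_euclid_degree_less:
  assumes "signed_euclid f1 f2 (Suc (Suc (Suc k))) \<noteq> 0"
  shows "degree (signed_euclid f1 f2 (Suc (Suc (Suc k)))) < degree (signed_euclid f1 f2 (Suc (Suc k)))"
  using assms degree_mod_less'[of "signed_euclid f1 f2 (Suc (Suc k))" "signed_euclid f1 f2 (Suc k)"]
  by (auto split: if_splits)

text \<open>The degrees strictly decrease from \<open>n - 1\<close>, so a single entry of degree \<open>n - j\<close> leaves no room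
  for a larger drop before it.\<close>
lemma signed_euclid_degrees:
  assumes "f1 \<noteq> 0" "degree f1 = n - 1" "degree f2 = n - 2" "2 \<le> n"
    and "signed_euclid f1 f2 j \<noteq> 0" "degree (signed_euclid f1 f2 j) = n - j"
    and "1 \<le> i" "i \<le> j" "j \<le> n"
  shows "degree (signed_euclid f1 f2 i) = n - i"
proof -
  let ?f = "signed_euclid f1 f2"
  have nz: "?f k \<noteq> 0" if "1 \<le> k" "k \<le> j" for k
    using signed_euclid_nonzero[OF assms(5,1)] that by blast
  have drop: "degree (?f (Suc k)) + 1 \<le> degree (?f k)" if k: "1 \<le> k" "Suc k \<le> j" for k
  proof (cases "k = 1")
    case True
    then show ?thesis using assms by (simp add: numeral_2_eq_2)
  next
    case False
    then obtain k' where "k = Suc (Suc k')"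
      using k(1) by (metis One_nat_def not0_implies_Suc not_one_le_zero)
    then show ?thesis
      using signed_euclid_degree_less[of f1 f2 k'] nz[of "Suc k"] k
      by (simp del: signed_euclid.simps)
  qed
  have "degree (?f k) + k \<le> n" if "1 \<le> k" "k \<le> j" for k
    using that
  proof (induction k rule: nat_induct_at_least)
    case base
    then show ?case using assms by simp
  next
    case (Suc k)
    then show ?case using drop[of k] by linarith
  qed
  from this[OF assms(7,8)] have "degree (?f i) + i \<le> n" .
  moreover have "degree (?f j) + (j - i) \<le> degree (?f i)"
    using \<open>i \<le> j\<close> \<open>1 \<le> i\<close>
  proof (induction i rule: inc_induct)
    case (step k)
    then show ?case using drop[of k] by linarith
  qed simp
  ultimately show ?thesis using assms(6-9) by linarith
qed

text \<open>The cofactors \<open>A\<close> and \<open>A'\<close> of two consecutive entries satisfy the same recursion as the entries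
  themselves, so the determinant formed with them does not change along the algorithm.\<close>
lemma signed_euclid_cofactors:
  fixes f1 f2 :: "'a::field poly"
  assumes "\<And>i. 1 \<le> i \<Longrightarrow> i \<le> Suc l \<Longrightarrow>
      signed_euclid f1 f2 i \<noteq> 0 \<and> degree (signed_euclid f1 f2 i) = n - i"
  obtains A A' where "degree A \<le> l" "degree A' \<le> l"
    "f1 dvd signed_euclid f1 f2 (Suc (Suc l)) - A * f2"
    "f1 dvd signed_euclid f1 f2 (Suc l) - A' * f2"
    "signed_euclid f1 f2 (Suc l) * A - signed_euclid f1 f2 (Suc (Suc l)) * A' = f1"
proof -
  let ?f = "signed_euclid f1 f2"
  have "\<exists>A A'. degree A \<le> l \<and> degree A' \<le> l \<and> f1 dvd ?f (Suc (Suc l)) - A * f2 \<and>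
    f1 dvd ?f (Suc l) - A' * f2 \<and> ?f (Suc l) * A - ?f (Suc (Suc l)) * A' = f1"
    using assms
  proof (induction l)
    case 0
    show ?case by (rule exI[of _ 1], rule exI[of _ 0]) simp
  next
    case (Suc l)
    then obtain A A' where A: "degree A \<le> l" "degree A' \<le> l" "f1 dvd ?f (Suc (Suc l)) - A * f2"
      "f1 dvd ?f (Suc l) - A' * f2" "?f (Suc l) * A - ?f (Suc (Suc l)) * A' = f1"
      by (metis le_Suc_eq)
    define q where "q = ?f (Suc l) div ?f (Suc (Suc l))"
    have nz: "?f (Suc (Suc l)) \<noteq> 0"
      and deg: "degree (?f (Suc l)) = n - Suc l" "degree (?f (Suc (Suc l))) = n - Suc (Suc l)"
      using Suc.prems[of "Suc l"] Suc.prems[of "Suc (Suc l)"] by auto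
    have f: "?f (Suc (Suc (Suc l))) = q * ?f (Suc (Suc l)) - ?f (Suc l)"
      using nz by (simp add: q_def minus_mod_eq_div_mult[symmetric])
    have "degree q \<le> 1"
    proof (cases "q = 0")
      case False
      have "degree (?f (Suc l) mod ?f (Suc (Suc l))) \<le> degree (?f (Suc (Suc l)))"
        using degree_mod_less[OF nz, of "?f (Suc l)"] by fastforce
      then have "degree (?f (Suc l) - ?f (Suc l) mod ?f (Suc (Suc l))) \<le> n - Suc l"
        using deg by (intro degree_diff_le) linarith+
      then have "degree (q * ?f (Suc (Suc l))) \<le> n - Suc l"
        unfolding q_def by (simp only: minus_mod_eq_div_mult)
      then have "degree q + (n - Suc (Suc l)) \<le> n - Suc l"
        using degree_mult_eq[OF False nz] deg(2) by simp
      then show ?thesis by linarith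
    qed simp
    then have "degree (q * A) \<le> Suc l"
      using A(1) degree_mult_le[of q A] by linarith
    then have "degree (q * A - A') \<le> Suc l"
      using A(2) by (intro degree_diff_le) auto
    moreover have "f1 dvd ?f (Suc (Suc (Suc l))) - (q * A - A') * f2"
    proof -
      have "?f (Suc (Suc (Suc l))) - (q * A - A') * f2
          = q * (?f (Suc (Suc l)) - A * f2) - (?f (Suc l) - A' * f2)"
        unfolding f by (simp add: algebra_simps del: signed_euclid.simps)
      with A(3,4) show ?thesis by (metis dvd_diff dvd_mult)
    qed
    moreover have "?f (Suc (Suc l)) * (q * A - A') - ?f (Suc (Suc (Suc l))) * A = f1"
      unfolding f using A(5) by (simp add: algebra_simps del: signed_euclid.simps)
    ultimately show ?case using A(1,3) le_SucI by blast
  qed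
  then show ?thesis using that by blast
qed

lemma dvd_cross_mult:
  fixes d g S A U h :: "'a::field poly"
  assumes "d dvd S - U * h" "d dvd g - A * h"
  shows "d dvd g * U - S * A"
proof -
  have "g * U - S * A = U * (g - A * h) - A * (S - U * h)"
    by (simp add: algebra_simps)
  with assms show ?thesis by (metis dvd_diff dvd_mult)
qed

text \<open>Uniqueness of a remainder with small cofactor: \<open>g * U - S * A\<close> is a multiple of \<open>f1\<close> of smaller
  degree, hence zero, while \<open>g' * U - S * A'\<close> is a scalar multiple \<open>w * f1\<close>. Eliminating \<open>U\<close> from
  the two relations gives \<open>S * f1 = w * g * f1\<close>.\<close>
lemma small_cofactors_proportional:
  fixes f1 f2 :: "'a::field poly"
  assumes "f1 \<noteq> 0"
    and S: "f1 dvd S - U * f2" and g: "f1 dvd g - A * f2" and g': "f1 dvd g' - A' * f2"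
    and det: "g' * A - g * A' = f1"
    and deg: "degree (S * A) < degree f1" "degree (g * U) < degree f1"
      "degree (S * A') < degree f1" "degree (g' * U) \<le> degree f1"
  shows "S = smult (coeff (g' * U) (degree f1) / lead_coeff f1) g"
proof -
  have "degree (g * U - S * A) < degree f1"
    using deg by (intro degree_diff_less) auto
  then have zero: "g * U = S * A"
    using dvd_cross_mult[OF S g] dvd_imp_degree_le[of f1 "g * U - S * A"] by fastforce
  from dvd_cross_mult[OF S g'] obtain W where W: "g' * U - S * A' = f1 * W"
    by (auto elim: dvdE)
  have "degree (f1 * W) \<le> degree f1"
    using deg unfolding W[symmetric] by (intro degree_diff_le) auto
  then have "degree W = 0"
    using \<open>f1 \<noteq> 0\<close> by (cases "W = 0") (auto simp: degree_mult_eq)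
  then obtain w where w: "W = [:w:]" by (auto elim: degree_eq_zeroE)
  have "coeff (g' * U) (degree f1) = w * lead_coeff f1"
    using arg_cong[OF W, of "\<lambda>p. coeff p (degree f1)"] coeff_eq_0[OF deg(3)] by (simp add: w)
  then have w_eq: "w = coeff (g' * U) (degree f1) / lead_coeff f1"
    using \<open>f1 \<noteq> 0\<close> by simp
  have "f1 * S = g' * (S * A) - g * (S * A')"
    unfolding det[symmetric] by (simp add: algebra_simps)
  also have "\<dots> = g * (g' * U - S * A')"
    unfolding zero[symmetric] by (simp add: algebra_simps)
  also have "\<dots> = f1 * smult w g"
    unfolding W w by (simp add: mult.commute)
  finally have "S = smult w g"
    using \<open>f1 \<noteq> 0\<close> by (simp only: mult_cancel_left) simp
  then show ?thesis unfolding w_eq .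
qed


section \<open>The factors gamma and the theorem\<close>

text \<open>Multiplying the recursion for \<open>\<gamma>_(j+1)\<close> by \<open>\<gamma>_j c(j)^2\<close> shows that this product is the same for
  every \<open>j\<close>; for \<open>j = 1\<close> it is \<open>\<alpha> 0\<close>.\<close>
lemma gamma_tilde_product:
  assumes "\<alpha> 0 \<noteq> 0" and "\<And>i. 1 \<le> i \<Longrightarrow> i \<le> Suc l \<Longrightarrow> c \<alpha> \<beta> i 0 \<noteq> 0"
  shows "gamma_tilde \<alpha> \<beta> (Suc l) * gamma_tilde \<alpha> \<beta> (Suc (Suc l)) * (c \<alpha> \<beta> (Suc l) 0)\<^sup>2 = \<alpha> 0"
  using assms(2)
proof (induction l)
  case 0
  then show ?case using assms(1) by (simp add: c_def c1_def)
next
  case (Suc l)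
  then have "c \<alpha> \<beta> (Suc (Suc l)) 0 \<noteq> 0" by simp
  moreover have "gamma_tilde \<alpha> \<beta> (Suc l) * gamma_tilde \<alpha> \<beta> (Suc (Suc l)) * (c \<alpha> \<beta> (Suc l) 0)\<^sup>2 = \<alpha> 0"
    using Suc by simp
  ultimately show ?case by (simp add: mult_ac)
qed

lemma signed_euclid_eq_minor_poly:
  fixes \<alpha> \<beta> :: "nat \<Rightarrow> 'a::field"
    and N j i :: nat
  defines "f1 \<equiv> dpoly (Suc N) \<alpha>" and "f2 \<equiv> dpoly N \<beta>"
  assumes "\<And>i. i > N + 1 \<Longrightarrow> \<alpha> i = 0" and "\<And>i. i > N \<Longrightarrow> \<beta> i = 0" and "\<alpha> 0 \<noteq> 0"
    and "j \<le> N + 2"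
    and regular: "\<And>i. 1 \<le> i \<Longrightarrow> i \<le> j \<Longrightarrow>
      signed_euclid f1 f2 i \<noteq> 0 \<and> degree (signed_euclid f1 f2 i) = N + 2 - i"
    and "1 \<le> i" "i \<le> j"
  shows "c \<alpha> \<beta> i 0 \<noteq> 0 \<and>
    signed_euclid f1 f2 i = smult (gamma_tilde \<alpha> \<beta> i) (dpoly (N + 2 - i) (c \<alpha> \<beta> i))"
  using \<open>1 \<le> i\<close> \<open>i \<le> j\<close>
proof (induction i rule: less_induct)
  case (less i)
  let ?f = "signed_euclid f1 f2"
  show ?case
  proof (cases "i = 1")
    case True
    then show ?thesis
      using assms(5) by (auto simp: f1_def c_def c1_def coeff_dpoly intro!: poly_eqI)
  next
    case False
    then obtain l where i: "i = Suc (Suc l)"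
      using less.prems by (metis One_nat_def not0_implies_Suc not_one_le_zero)
    have l: "l \<le> N" using i less.prems \<open>j \<le> N + 2\<close> by simp
    let ?g' = "?f (Suc l)" and ?g = "?f (Suc (Suc l))"
      and ?S = "dpoly (N - l) (c \<alpha> \<beta> (Suc (Suc l)))"
      and ?\<gamma> = "gamma_tilde \<alpha> \<beta> (Suc l)" and ?c = "c \<alpha> \<beta> (Suc l) 0"
    have deg_f1: "degree f1 = Suc N" and lc_f1: "lead_coeff f1 = \<alpha> 0"
      using assms(5) by (simp_all add: f1_def degree_dpoly coeff_dpoly)
    have nz: "f1 \<noteq> 0" using deg_f1 by auto
    have cnz: "c \<alpha> \<beta> k 0 \<noteq> 0" if "1 \<le> k" "k \<le> Suc l" for k
      using less.IH[of k] that i less.prems by simp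
    have c_nz: "?c \<noteq> 0" by (rule cnz) auto
    have g': "?g' = smult ?\<gamma> (dpoly (Suc N - l) (c \<alpha> \<beta> (Suc l)))"
      using less.IH[of "Suc l"] i less.prems by simp
    have deg_g': "degree ?g' = Suc N - l"
      using regular[of "Suc l"] i less.prems by simp
    have deg_g: "degree ?g = N - l" and g_nz: "?g \<noteq> 0"
      using regular[of "Suc (Suc l)"] i less.prems by auto
    obtain A A' where A: "degree A \<le> l" "degree A' \<le> l"
      "f1 dvd ?g - A * f2" "f1 dvd ?g' - A' * f2" "?g' * A - ?g * A' = f1"
      using regular i less.prems by (rule_tac signed_euclid_cofactors[of l f1 f2 "N + 2"]) auto
    obtain U where U: "degree U \<le> l" "coeff U l = ?c" "f1 dvd ?S - U * f2"
      using minor_poly_cong[of N \<alpha> \<beta> l] assms(3-5) l unfolding f1_def f2_def by metis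
    have deg_U: "degree U = l"
      using U(1,2) c_nz by (intro antisym le_degree) auto
    have deg_S: "degree ?S \<le> N - l" by (rule degree_dpoly_le)
    have S: "?S = smult (coeff (?g' * U) (degree f1) / lead_coeff f1) ?g"
    proof (rule small_cofactors_proportional[OF nz U(3) A(3,4,5)])
      show "degree (?S * A) < degree f1"
        using degree_mult_le[of ?S A] deg_S A(1) l deg_f1 by linarith
      show "degree (?S * A') < degree f1"
        using degree_mult_le[of ?S A'] deg_S A(2) l deg_f1 by linarith
      show "degree (?g * U) < degree f1"
        using degree_mult_le[of ?g U] deg_g deg_U l deg_f1 by linarith
      show "degree (?g' * U) \<le> degree f1"
        using degree_mult_le[of ?g' U] deg_g' deg_U l deg_f1 by linarith
    qed
    have "coeff (?g' * U) (degree f1) = lead_coeff ?g' * lead_coeff U"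
      using coeff_mult_degree_sum[of ?g' U] deg_g' deg_U deg_f1 l by simp
    also have "\<dots> = ?\<gamma> * ?c\<^sup>2"
    proof -
      have "coeff ?g' (Suc N - l) = ?\<gamma> * ?c"
        unfolding g' by (simp add: coeff_dpoly)
      then show ?thesis
        unfolding deg_g' deg_U U(2) by (simp add: power2_eq_square)
    qed
    finally have S_eq: "?S = smult (?\<gamma> * ?c\<^sup>2 / \<alpha> 0) ?g"
      using S lc_f1 by (simp del: signed_euclid.simps)
    have prod: "?\<gamma> * gamma_tilde \<alpha> \<beta> (Suc (Suc l)) * ?c\<^sup>2 = \<alpha> 0"
      using assms(5) cnz by (rule gamma_tilde_product)
    then have "smult (gamma_tilde \<alpha> \<beta> (Suc (Suc l))) ?S = ?g"
      unfolding S_eq using assms(5)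
      by (simp add: mult_ac del: signed_euclid.simps gamma_tilde.simps)
    moreover have "c \<alpha> \<beta> (Suc (Suc l)) 0 \<noteq> 0"
    proof -
      have "c \<alpha> \<beta> (Suc (Suc l)) 0 = coeff ?S (N - l)"
        by (simp add: coeff_dpoly)
      also have "\<dots> = ?\<gamma> * ?c\<^sup>2 / \<alpha> 0 * lead_coeff ?g"
        unfolding S_eq deg_g by simp
      also have "\<dots> \<noteq> 0"
        using prod g_nz assms(5) c_nz by (auto simp del: signed_euclid.simps)
      finally show ?thesis .
    qed
    ultimately show ?thesis
      by (simp add: i del: signed_euclid.simps gamma_tilde.simps)
  qed
qed

theorem mainTheorem2:
  fixes n j :: nat
    and \<alpha> \<beta> :: "nat \<Rightarrow> 'k::field_char_0"
    and f1 f2 :: "'k poly"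
    and f :: "nat \<Rightarrow> 'k poly"
  assumes "n \<ge> 2"
    and "f1 = (\<Sum>i\<le>n - 1. monom (\<alpha> i) (n - 1 - i))"
    and "f2 = (\<Sum>i\<le>n - 2. monom (\<beta> i) (n - 2 - i))"
    and "\<alpha> 0 \<noteq> 0" and "\<beta> 0 \<noteq> 0"
    and "\<And>i. i > n - 1 \<Longrightarrow> \<alpha> i = 0"
    and "\<And>i. i > n - 2 \<Longrightarrow> \<beta> i = 0"
    and "f = signed_euclid f1 f2"
    and "j \<ge> 1" and "j \<le> n"
    and "f j \<noteq> 0" and "degree (f j) = n - j"
  shows "\<forall>i\<in>{1..j}.
           degree (f i) = n - i \<and>
           c \<alpha> \<beta> i 0 \<noteq> 0 \<and>
           f i = smult (gamma_tilde \<alpha> \<beta> i) (\<Sum>p\<le>n - i. monom (c \<alpha> \<beta> i p) (n - i - p)) \<and>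
           lead_coeff (f i) = gamma_tilde \<alpha> \<beta> i * c \<alpha> \<beta> i 0"
proof
  fix i assume i: "i \<in> {1..j}"
  define N where "N = n - 2"
  have n: "n = N + 2" using assms(1) by (simp add: N_def)
  have f1: "f1 = dpoly (Suc N) \<alpha>" and f2: "f2 = dpoly N \<beta>"
    using assms(2,3) by (simp_all add: n dpoly_def)
  have deg1: "degree f1 = n - 1" and deg2: "degree f2 = n - 2"
    unfolding f1 f2 using assms(4,5) by (simp_all add: degree_dpoly n)
  have nz: "f1 \<noteq> 0" using deg1 n by auto
  have regular: "f k \<noteq> 0 \<and> degree (f k) = n - k" if "1 \<le> k" "k \<le> j" for k
    using that signed_euclid_nonzero[of f1 f2 j k]
      signed_euclid_degrees[OF nz deg1 deg2 assms(1), of j k] assms(8-12) nz by simp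
  have main: "c \<alpha> \<beta> i 0 \<noteq> 0 \<and> f i = smult (gamma_tilde \<alpha> \<beta> i) (dpoly (n - i) (c \<alpha> \<beta> i))"
    unfolding assms(8) f1 f2 n
  proof (rule signed_euclid_eq_minor_poly)
    show "signed_euclid (dpoly (Suc N) \<alpha>) (dpoly N \<beta>) k \<noteq> 0 \<and>
        degree (signed_euclid (dpoly (Suc N) \<alpha>) (dpoly N \<beta>) k) = N + 2 - k"
      if "1 \<le> k" "k \<le> j" for k
      using regular[OF that] unfolding assms(8) f1 f2 n .
  qed (use assms i n in auto)
  have deg: "degree (f i) = n - i" using regular[of i] i by simp
  have "coeff (f i) (n - i) = gamma_tilde \<alpha> \<beta> i * c \<alpha> \<beta> i 0"
    using main by (simp add: coeff_dpoly)
  with main deg show "degree (f i) = n - i \<and> c \<alpha> \<beta> i 0 \<noteq> 0 \<and>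
      f i = smult (gamma_tilde \<alpha> \<beta> i) (\<Sum>p\<le>n - i. monom (c \<alpha> \<beta> i p) (n - i - p)) \<and>
      lead_coeff (f i) = gamma_tilde \<alpha> \<beta> i * c \<alpha> \<beta> i 0"
    unfolding dpoly_def by metis
qed

end
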